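(* Let $N \geq 2$ and let $\Omega \subset \mathbb{R}^N$ be an open set with finite $N$-dimensional Lebesgue measure. Let $v: \Omega \to \mathbb{R}^N$ be a Borel vectorfield. Then, for any $\epsilon>0$, there exist an open set $A \subset \Omega$ and a function $\phi \in C^1_0(\Omega)$ such that $\mathscr{H}^N(A) \leq \epsilon\, \mathscr{H}^N(\Omega)$ and $v=\nabla \phi$ on $\Omega \setminus A$.
   Context: $\mathscr{H}^N$ denotes the $N$-dimensional Hausdorff measure on $\mathbb{R}^N$, normalised to agree with Lebesgue measure. $C^1_0(\Omega)$ is the Banach space of real-valued $C^1$ functions on $\Omega$ obtained as the closure of $C^1_c(\Omega)$ (the compactly supported $C^1$ functions) in the norm $\|\phi\|_{C^1}=\sup_\Omega|\phi|+\sup_\Omega|\nabla\phi|$. *)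

theory Defs
  imports "HOL-Analysis.Analysis"
begin

text \<open>
  A function on an open set \<open>\<Omega>\<close> is represented by a total function, of which only the values on
  \<open>\<Omega>\<close> are relevant; since \<open>\<Omega>\<close> is open, these determine the derivatives at points of \<open>\<Omega>\<close>.
\<close>

text \<open>Unspecified at points where \<open>f\<close> is not differentiable.\<close>

definition gradient :: "('a::euclidean_space \<Rightarrow> real) \<Rightarrow> 'a \<Rightarrow> 'a" where
  "gradient f x = (THE D. GDERIV f x :> D)"

lemma gradient_eqI:
  fixes f :: "'a::euclidean_space \<Rightarrow> real"
  assumes "GDERIV f x :> D"
  shows "gradient f x = D"
  unfolding gradient_def
proof (rule the_equality)
  fix E assume "GDERIV f x :> E"
  then have "(\<lambda>h. inner h E) = (\<lambda>h. inner h D)"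
    using assms unfolding gderiv_def by (rule has_derivative_unique)
  then have "inner h E = inner h D" for h
    by (rule fun_cong)
  then show "E = D"
    using vector_eq_ldot by blast
qed (fact assms)

lemma GDERIV_gradient:
  fixes f :: "'a::euclidean_space \<Rightarrow> real"
  assumes "f differentiable (at x)"
  shows "GDERIV f x :> gradient f x"
proof -
  obtain f' where f': "(f has_derivative f') (at x)"
    using assms unfolding differentiable_def by blast
  then interpret linear f'
    by (rule has_derivative_linear)
  have "f' h = inner h (adjoint f' 1)" for h
    using adjoint_works[OF linear_axioms, of h 1] by simp
  then have "f' = (\<lambda>h. inner h (adjoint f' 1))"
    by (rule ext)
  then have *: "GDERIV f x :> adjoint f' 1"
    unfolding gderiv_def using f' by simp
  show ?thesis
    unfolding gradient_eqI[OF *] by (rule *)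
qed

definition C1 :: "'a::euclidean_space set \<Rightarrow> ('a \<Rightarrow> real) set" where
  "C1 \<Omega> = {\<phi>. (\<forall>x\<in>\<Omega>. \<phi> differentiable (at x)) \<and> continuous_on \<Omega> (gradient \<phi>)}"

text \<open>The support is the closure relative to \<open>\<Omega>\<close> of the set where \<open>\<phi>\<close> does not vanish.\<close>

definition C1c :: "'a::euclidean_space set \<Rightarrow> ('a \<Rightarrow> real) set" where
  "C1c \<Omega> = {\<phi> \<in> C1 \<Omega>. compact (\<Omega> \<inter> closure {x\<in>\<Omega>. \<phi> x \<noteq> 0})}"

text \<open>
  Extended values are used so that the suprema are meaningful for unbounded functions, where
  the norm is \<open>\<infinity>\<close>.
\<close>

definition C1_norm :: "'a::euclidean_space set \<Rightarrow> ('a \<Rightarrow> real) \<Rightarrow> ennreal" where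
  "C1_norm \<Omega> \<phi> = (SUP x\<in>\<Omega>. ennreal \<bar>\<phi> x\<bar>) + (SUP x\<in>\<Omega>. ennreal (norm (gradient \<phi> x)))"

text \<open>
  The closure of \<open>C1c \<Omega>\<close> in the \<open>C1_norm\<close>. Elements of \<open>C1c \<Omega>\<close> have finite norm, hence so do
  all elements of the closure, and no boundedness condition needs to be imposed.
\<close>

definition C1_0 :: "'a::euclidean_space set \<Rightarrow> ('a \<Rightarrow> real) set" where
  "C1_0 \<Omega> = {\<phi> \<in> C1 \<Omega>. \<forall>\<delta>>0::real. \<exists>\<psi>\<in>C1c \<Omega>. C1_norm \<Omega> (\<lambda>x. \<phi> x - \<psi> x) < ennreal \<delta>}"

end

theory Submission
  imports Defs
begin

text \<open>
  A gradient cannot equal a prescribed field \<open>v\<close> on an open set unless \<open>v\<close> is conservative, but it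
  can be made to agree with \<open>v\<close> on a set of almost full measure, because the obstruction can be
  concentrated where nothing is prescribed.

  The core is one approximation step (\<open>gradient_approximation_on_balls\<close>). Let \<open>v\<close> be continuous with
  \<open>\<bar>v\<bar> \<le> M\<close>. By Vitali's theorem, finitely many disjoint balls, so small that \<open>v\<close> is nearly constant on
  each, fill almost all of \<open>\<Omega>\<close>. On the ball with centre \<open>a\<close> take the linear function
  \<open>(x - a) \<bullet> v a\<close>, whose gradient is \<open>v a\<close>, multiplied by a cutoff that is \<open>1\<close> on the concentric ball
  of \<open>\<rho>\<close> times the radius \<open>r\<close>. The linear function is at most \<open>r M\<close> on the ball, and the gradient of
  the cutoff is of order \<open>1 / ((1 - \<rho>) r)\<close>, so the radius cancels: the gradient of the product is at
  most a constant times \<open>M\<close>, where the constant depends on \<open>\<rho>\<close>, that is, on the measure that one is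
  ready to lose, but not on \<open>v\<close> or on the desired accuracy. The functions themselves are as small
  as one likes.

  This independence is what makes an iteration possible (\<open>Lusin_gradient_continuous\<close>). The error
  left by a step is small on a compact set; by Tietze's theorem it extends to a continuous field with
  the same bound, to which the next step is applied. The loss of measure allowed in step \<open>n\<close> is
  fixed beforehand as a fraction \<open>2\<^bsup>-n-1\<^esup>\<close> of the total loss. This fixes the constant \<open>c n\<close> of the step, and
  the accuracy of the preceding step can then be chosen so small that the gradient produced in step
  \<open>n\<close> is at most \<open>B / 2\<^bsup>n\<^esup>\<close>. The sum of all the functions converges in the \<open>C\<^sup>1\<close> norm, and on the
  intersection of the compact sets its gradient is \<open>v\<close> by telescoping.

  Lusin's theorem (\<open>Lusin_continuous_on_compact\<close>) and Tietze's theorem reduce a Borel field to a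
  bounded continuous one.
\<close>

section \<open>Cutoff functions\<close>

lemma DERIV_positive_part_squared:
  fixes u :: real
  shows "((\<lambda>u. (max 0 u)\<^sup>2) has_real_derivative 2 * max 0 u) (at u)"
proof -
  consider "u > 0" | "u < 0" | "u = 0" by linarith
  then show ?thesis
  proof cases
    case 1
    have "((\<lambda>u. u\<^sup>2) has_real_derivative 2 * u) (at u)"
      by (auto intro!: derivative_eq_intros)
    then show ?thesis
      by (rule has_field_derivative_transform_within_open[where S="{0<..}", THEN DERIV_cong])
        (use 1 in auto)
  next
    case 2
    have "((\<lambda>u. 0) has_real_derivative 0) (at u)"
      by simp
    then show ?thesis
      by (rule has_field_derivative_transform_within_open[where S="{..<0}", THEN DERIV_cong])
        (use 2 in auto)
  next
    case 3
    have "((\<lambda>h. (max 0 h)\<^sup>2 / h) \<longlongrightarrow> 0) (at (0::real))"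
    proof (rule tendsto_0_le[where K=1])
      show "((\<lambda>h. h) \<longlongrightarrow> 0) (at (0::real))" by (rule tendsto_ident_at)
      show "\<forall>\<^sub>F h in at (0::real). norm ((max 0 h)\<^sup>2 / h) \<le> norm h * 1"
        by (rule always_eventually) (auto simp: max_def power2_eq_square)
    qed
    then show ?thesis
      using 3 by (simp add: DERIV_def)
  qed
qed

text \<open>
  A cutoff on the line that is only \<open>C\<^sup>1\<close> has a closed form: with \<open>p u = (max 0 u)\<^sup>2\<close>, the function
  \<open>1 - p u\<close> equals \<open>1\<close> for \<open>u \<le> 0\<close> and is nonpositive for \<open>u \<ge> 1\<close>, and a second application of \<open>p\<close>
  turns these nonpositive values into \<open>0\<close> without destroying differentiability. Both factors of the
  derivative lie in \<open>[0, 2]\<close> where the product is nonzero, which gives the \<open>4\<close>; the denominator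
  comes from rescaling \<open>[s, 1]\<close> to \<open>[0, 1]\<close>.
\<close>

lemma cutoff_profile:
  fixes s :: real
  assumes "s < 1"
  obtains g g' :: "real \<Rightarrow> real" where
    "\<And>t. (g has_real_derivative g' t) (at t)" "continuous_on UNIV g'"
    "\<And>t. t \<le> s \<Longrightarrow> g t = 1 \<and> g' t = 0" "\<And>t. t \<ge> 1 \<Longrightarrow> g t = 0 \<and> g' t = 0"
    "\<And>t. \<bar>g t\<bar> \<le> 1" "\<And>t. \<bar>g' t\<bar> \<le> 4 / (1 - s)"
proof -
  define p :: "real \<Rightarrow> real" where "p = (\<lambda>u. (max 0 u)\<^sup>2)"
  define q where "q t = (t - s) / (1 - s)" for t
  define g where "g t = p (1 - p (q t))" for t
  define g' where "g' t = 2 * max 0 (1 - p (q t)) * (- (2 * max 0 (q t) * (1 / (1 - s))))" for t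
  note Dp = DERIV_positive_part_squared[folded p_def]
  have Dg: "(g has_real_derivative g' t) (at t)" for t
  proof -
    have "(q has_real_derivative 1 / (1 - s)) (at t)"
      unfolding q_def using assms by (auto intro!: derivative_eq_intros)
    from DERIV_chain2[OF Dp this]
    have "((\<lambda>t. 1 - p (q t)) has_real_derivative - (2 * max 0 (q t) * (1 / (1 - s)))) (at t)"
      by (auto intro!: derivative_eq_intros)
    from DERIV_chain2[OF Dp this] show ?thesis
      unfolding g_def g'_def .
  qed
  have lo: "q t \<le> 0" if "t \<le> s" for t
    using that assms by (auto simp: q_def divide_nonpos_pos)
  have hi: "q t \<ge> 1" if "t \<ge> 1" for t
    using that assms by (auto simp: q_def field_simps)
  have p_ge: "p u \<ge> 1" if "u \<ge> 1" for u
    using that by (simp add: p_def)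
  have p01: "0 \<le> p u" "u \<le> 1 \<Longrightarrow> p u \<le> 1" for u
    using power_mono[of "max 0 u" 1 2] by (auto simp: p_def)
  have b: "\<bar>max 0 (1 - p (q t)) * max 0 (q t)\<bar> \<le> 1" for t
  proof (cases "q t \<ge> 1")
    case True
    then show ?thesis using p_ge[of "q t"] by simp
  next
    case False
    then show ?thesis using p01[of "q t"] by (auto simp: abs_mult intro!: mult_le_one)
  qed
  show thesis
  proof
    show "(g has_real_derivative g' t) (at t)" for t by (rule Dg)
    show "continuous_on UNIV g'"
      unfolding g'_def p_def q_def using assms by (intro continuous_intros) auto
    show "g t = 1 \<and> g' t = 0" if "t \<le> s" for t
      using lo[OF that] by (simp add: g_def g'_def p_def)
    show "g t = 0 \<and> g' t = 0" if "t \<ge> 1" for t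
      using p_ge[OF hi[OF that]] by (simp add: g_def g'_def) (simp add: p_def)
    show "\<bar>g t\<bar> \<le> 1" for t
      using p01[of "1 - p (q t)"] p01(1)[of "q t"] by (simp add: g_def)
    show "\<bar>g' t\<bar> \<le> 4 / (1 - s)" for t
    proof -
      have "\<bar>g' t\<bar> = (4 / (1 - s)) * \<bar>max 0 (1 - p (q t)) * max 0 (q t)\<bar>"
        using assms by (simp add: g'_def abs_mult)
      also have "\<dots> \<le> (4 / (1 - s)) * 1"
        using b assms by (intro mult_left_mono) auto
      finally show ?thesis by simp
    qed
  qed
qed

lemma GDERIV_inner_diff: "GDERIV (\<lambda>x. (x - a) \<bullet> w) x :> w"
  unfolding gderiv_def by (auto intro!: derivative_eq_intros)

text \<open>
  The bound on the gradient does not involve \<open>r\<close>: the derivative of the cutoff grows like \<open>1 / r\<close>,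
  but it multiplies a linear function of size \<open>r * norm w\<close>. The cutoff profile is evaluated at
  \<open>(norm (x - a) / r)\<^sup>2\<close>, which, unlike the norm, is differentiable at the centre.
\<close>

lemma localized_linear_function:
  fixes a w :: "'a::euclidean_space"
  assumes "0 < r" "0 < \<rho>" "\<rho> < 1"
  obtains \<phi> G where
    "\<And>x. GDERIV \<phi> x :> G x" "continuous_on UNIV G"
    "\<And>x. \<bar>\<phi> x\<bar> \<le> r * norm w" "\<And>x. norm (G x) \<le> (1 + 8 / (1 - \<rho>\<^sup>2)) * norm w"
    "\<And>x. x \<notin> ball a r \<Longrightarrow> \<phi> x = 0 \<and> G x = 0"
    "\<And>x. x \<in> cball a (\<rho> * r) \<Longrightarrow> G x = w"
proof -
  have \<rho>1: "\<rho>\<^sup>2 < 1"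
    using assms by (simp add: power_less_one_iff)
  obtain g g' :: "real \<Rightarrow> real" where
    Dg: "\<And>t. (g has_real_derivative g' t) (at t)" and cg': "continuous_on UNIV g'"
    and lo: "\<And>t. t \<le> \<rho>\<^sup>2 \<Longrightarrow> g t = 1 \<and> g' t = 0" and hi: "\<And>t. t \<ge> 1 \<Longrightarrow> g t = 0 \<and> g' t = 0"
    and b: "\<And>t. \<bar>g t\<bar> \<le> 1" and b': "\<And>t. \<bar>g' t\<bar> \<le> 4 / (1 - \<rho>\<^sup>2)"
    using cutoff_profile[OF \<rho>1] by metis
  define t where "t x = ((x - a) \<bullet> (x - a)) / r\<^sup>2" for x
  define \<phi> where "\<phi> x = g (t x) * ((x - a) \<bullet> w)" for x
  define G where "G x = g (t x) *\<^sub>R w + ((x - a) \<bullet> w) *\<^sub>R (g' (t x) *\<^sub>R ((2 / r\<^sup>2) *\<^sub>R (x - a)))" for x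
  have cg: "continuous_on UNIV g"
    using Dg by (meson DERIV_isCont continuous_at_imp_continuous_on)
  have ct: "continuous_on UNIV t"
    unfolding t_def using assms by (intro continuous_intros) auto
  have t_norm: "t x = (norm (x - a) / r)\<^sup>2" for x
    by (simp add: t_def power2_norm_eq_inner power_divide)
  have t_hi: "t x \<ge> 1" if "x \<notin> ball a r" for x
  proof -
    have "1 \<le> norm (x - a) / r" using that assms by (simp add: dist_norm norm_minus_commute)
    from power_mono[OF this, of 2] show ?thesis by (simp add: t_norm)
  qed
  have t_lo: "t x \<le> \<rho>\<^sup>2" if "x \<in> cball a (\<rho> * r)" for x
  proof -
    have "norm (x - a) / r \<le> \<rho>"
      using that assms by (simp add: dist_norm norm_minus_commute field_simps)
    from power_mono[OF this, of 2] assms show ?thesis by (simp add: t_norm)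
  qed
  have out: "\<phi> x = 0 \<and> G x = 0" if "x \<notin> ball a r" for x
    using hi[OF t_hi[OF that]] by (simp add: \<phi>_def G_def)
  have inn: "\<bar>(x - a) \<bullet> w\<bar> \<le> r * norm w" if "x \<in> ball a r" for x
  proof -
    have "norm (x - a) * norm w \<le> r * norm w"
      using that by (intro mult_right_mono) (auto simp: dist_norm norm_minus_commute)
    then show ?thesis using Cauchy_Schwarz_ineq2[of "x - a" w] by linarith
  qed
  show thesis
  proof
    fix x
    have "GDERIV t x :> (2 / r\<^sup>2) *\<^sub>R (x - a)"
      unfolding gderiv_def t_def using assms
      by (auto intro!: derivative_eq_intros simp: inner_commute field_simps inner_diff_right)
    from GDERIV_mult[OF GDERIV_DERIV_compose[OF this Dg] GDERIV_inner_diff]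
    show "GDERIV \<phi> x :> G x"
      unfolding \<phi>_def G_def .
    show "\<bar>\<phi> x\<bar> \<le> r * norm w"
    proof (cases "x \<in> ball a r")
      case True
      then show ?thesis using mult_mono[OF b[of "t x"] inn[OF True]] by (simp add: \<phi>_def abs_mult)
    qed (use out assms in simp)
    show "norm (G x) \<le> (1 + 8 / (1 - \<rho>\<^sup>2)) * norm w"
    proof (cases "x \<in> ball a r")
      case True
      have nxr: "norm (x - a) \<le> r" using True by (simp add: dist_norm norm_minus_commute)
      have "\<bar>(x - a) \<bullet> w\<bar> * (\<bar>g' (t x)\<bar> * ((2 / r\<^sup>2) * norm (x - a)))
          \<le> (r * norm w) * (4 / (1 - \<rho>\<^sup>2) * ((2 / r\<^sup>2) * r))"
        using inn[OF True] b'[of "t x"] nxr assms \<rho>1 by (intro mult_mono) auto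
      also have "\<dots> = 8 / (1 - \<rho>\<^sup>2) * norm w"
        using assms by (simp add: power2_eq_square)
      finally have 1: "norm (((x - a) \<bullet> w) *\<^sub>R (g' (t x) *\<^sub>R ((2 / r\<^sup>2) *\<^sub>R (x - a)))) \<le> 8 / (1 - \<rho>\<^sup>2) * norm w"
        by (simp add: abs_mult mult_ac)
      have 2: "norm (g (t x) *\<^sub>R w) \<le> norm w"
        using mult_right_mono[OF b[of "t x"], of "norm w"] by simp
      show ?thesis
        unfolding G_def using norm_triangle_le[OF add_mono[OF 2 1]] by (simp add: ring_distribs)
    qed (use out assms \<rho>1 in simp)
    show "\<phi> x = 0 \<and> G x = 0" if "x \<notin> ball a r" using out[OF that] .
    show "G x = w" if "x \<in> cball a (\<rho> * r)"
      using lo[OF t_lo[OF that]] by (simp add: G_def)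
  next
    show "continuous_on UNIV G"
      unfolding G_def
      by (intro continuous_intros continuous_on_compose2[OF cg ct] continuous_on_compose2[OF cg' ct]) auto
  qed
qed

section \<open>Compactly supported functions and their series\<close>

text \<open>
  The gradient is carried as a separate argument, so that sums and series can be handled without the
  description operator in \<open>gradient\<close>. The conditions are imposed on the whole space: the functions
  vanish off a compact subset of \<open>\<Omega>\<close>, and derivatives on a convex domain are needed for series.
\<close>

definition test_function :: "'a::euclidean_space set \<Rightarrow> ('a \<Rightarrow> real) \<Rightarrow> ('a \<Rightarrow> 'a) \<Rightarrow> bool" where
  "test_function \<Omega> \<phi> G \<longleftrightarrow> (\<forall>x. GDERIV \<phi> x :> G x) \<and> continuous_on UNIV G \<and>
     (\<exists>L. compact L \<and> L \<subseteq> \<Omega> \<and> (\<forall>x. x \<notin> L \<longrightarrow> \<phi> x = 0))"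

lemma test_function_sum:
  assumes "finite F" "\<And>i. i \<in> F \<Longrightarrow> test_function \<Omega> (\<phi> i) (G i)"
  shows "test_function \<Omega> (\<lambda>x. \<Sum>i\<in>F. \<phi> i x) (\<lambda>x. \<Sum>i\<in>F. G i x)"
proof -
  obtain L where L: "\<And>i. i \<in> F \<Longrightarrow> compact (L i) \<and> L i \<subseteq> \<Omega> \<and> (\<forall>x. x \<notin> L i \<longrightarrow> \<phi> i x = 0)"
    using assms(2) unfolding test_function_def by metis
  show ?thesis
    unfolding test_function_def
  proof (intro conjI allI exI[of _ "\<Union>i\<in>F. L i"])
    show "GDERIV (\<lambda>x. \<Sum>i\<in>F. \<phi> i x) x :> (\<Sum>i\<in>F. G i x)" for x
      unfolding gderiv_def inner_sum_right
      using assms(2) by (intro has_derivative_sum) (simp add: test_function_def gderiv_def)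
    show "continuous_on UNIV (\<lambda>x. \<Sum>i\<in>F. G i x)"
      using assms(2) by (intro continuous_on_sum) (simp add: test_function_def)
    show "compact (\<Union>i\<in>F. L i)"
      using assms(1) L by (intro compact_UN) auto
    show "(\<Union>i\<in>F. L i) \<subseteq> \<Omega>" using L by auto
    show "x \<notin> (\<Union>i\<in>F. L i) \<longrightarrow> (\<Sum>i\<in>F. \<phi> i x) = 0" for x
      using L by (auto intro!: sum.neutral)
  qed
qed

lemma test_function_C1c:
  assumes "test_function \<Omega> \<phi> G"
  shows "\<phi> \<in> C1c \<Omega>" "gradient \<phi> = G"
proof -
  have D: "GDERIV \<phi> x :> G x" for x
    using assms by (simp add: test_function_def)
  then show grad: "gradient \<phi> = G"
    by (intro ext gradient_eqI)
  obtain L where L: "compact L" "L \<subseteq> \<Omega>" "\<And>x. x \<notin> L \<Longrightarrow> \<phi> x = 0"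
    using assms unfolding test_function_def by blast
  have "closure {x\<in>\<Omega>. \<phi> x \<noteq> 0} \<subseteq> L"
    using L by (intro closure_minimal) (auto simp: compact_imp_closed)
  then have "\<Omega> \<inter> closure {x\<in>\<Omega>. \<phi> x \<noteq> 0} = L \<inter> closure {x\<in>\<Omega>. \<phi> x \<noteq> 0}"
    using L(2) by blast
  then have "compact (\<Omega> \<inter> closure {x\<in>\<Omega>. \<phi> x \<noteq> 0})"
    using L(1) by (simp add: compact_Int_closed)
  moreover have "\<phi> differentiable (at x)" for x
    using D[of x] unfolding gderiv_def differentiable_def by blast
  moreover have "continuous_on \<Omega> G"
    using assms unfolding test_function_def by (blast intro: continuous_on_subset)
  ultimately show "\<phi> \<in> C1c \<Omega>"
    unfolding C1c_def C1_def by (simp add: grad)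
qed

text \<open>
  Elements of \<open>C1_0 \<Omega>\<close> arise as limits of partial sums. The Weierstrass test makes both the series and
  the series of gradients converge uniformly, so that differentiation is termwise.
\<close>

lemma C1_0_series:
  assumes tf: "\<And>n::nat. test_function \<Omega> (\<phi> n) (G n)"
    and b: "\<And>n x. \<bar>\<phi> n x\<bar> \<le> b n" "\<And>n x. norm (G n x) \<le> b n" and "summable b"
  shows "(\<lambda>x. \<Sum>n. \<phi> n x) \<in> C1_0 \<Omega>" "gradient (\<lambda>x. \<Sum>n. \<phi> n x) = (\<lambda>x. \<Sum>n. G n x)"
proof -
  define \<Phi> where "\<Phi> = (\<lambda>x. \<Sum>n. \<phi> n x)"
  define \<Gamma> where "\<Gamma> = (\<lambda>x. \<Sum>n. G n x)"
  have u\<phi>: "uniform_limit UNIV (\<lambda>n x. \<Sum>i<n. \<phi> i x) \<Phi> sequentially"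
    unfolding \<Phi>_def using b(1) \<open>summable b\<close> by (intro Weierstrass_m_test) auto
  have uG: "uniform_limit UNIV (\<lambda>n x. \<Sum>i<n. G i x) \<Gamma> sequentially"
    unfolding \<Gamma>_def using b(2) \<open>summable b\<close> by (intro Weierstrass_m_test) auto
  have partial: "test_function \<Omega> (\<lambda>x. \<Sum>i<n. \<phi> i x) (\<lambda>x. \<Sum>i<n. G i x)" for n
    using tf by (intro test_function_sum) auto
  have sums: "(\<lambda>n. \<phi> n x) sums \<Phi> x" for x
    unfolding \<Phi>_def by (intro summable_sums summable_comparison_test'[OF \<open>summable b\<close>, of 0]) (simp add: b(1))
  have "\<exists>g. \<forall>x\<in>UNIV. (\<lambda>n. \<phi> n x) sums g x \<and> (g has_derivative (\<lambda>h. h \<bullet> \<Gamma> x)) (at x within UNIV)"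
  proof (rule has_derivative_series[where f' = "\<lambda>n x h. h \<bullet> G n x"])
    show "(\<phi> n has_derivative (\<lambda>h. h \<bullet> G n x)) (at x within UNIV)" for n x
      using tf[of n] by (simp add: test_function_def gderiv_def)
    show "\<forall>\<^sub>F n in sequentially. \<forall>x\<in>UNIV. \<forall>h. norm ((\<Sum>i<n. h \<bullet> G i x) - h \<bullet> \<Gamma> x) \<le> e * norm h"
      if "e > 0" for e
      using uniform_limitD[OF uG that]
    proof eventually_elim
      case (elim n)
      show ?case
      proof (intro ballI allI)
        fix x h
        have "norm ((\<Sum>i<n. h \<bullet> G i x) - h \<bullet> \<Gamma> x) = \<bar>h \<bullet> ((\<Sum>i<n. G i x) - \<Gamma> x)\<bar>"
          by (simp add: inner_sum_right inner_diff_right)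
        also have "\<dots> \<le> norm h * norm ((\<Sum>i<n. G i x) - \<Gamma> x)"
          by (rule Cauchy_Schwarz_ineq2)
        also have "\<dots> \<le> norm h * e"
          using elim by (intro mult_left_mono) (auto simp: dist_norm less_imp_le)
        finally show "norm ((\<Sum>i<n. h \<bullet> G i x) - h \<bullet> \<Gamma> x) \<le> e * norm h"
          by (simp add: mult.commute)
      qed
    qed
    show "(\<lambda>n. \<phi> n 0) sums \<Phi> 0" by (rule sums)
  qed auto
  then obtain g where g: "\<And>x. (\<lambda>n. \<phi> n x) sums g x" "\<And>x. (g has_derivative (\<lambda>h. h \<bullet> \<Gamma> x)) (at x)"
    by auto
  have "g = \<Phi>"
    using g(1) sums sums_unique2 by blast
  then have D: "GDERIV \<Phi> x :> \<Gamma> x" for x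
    using g(2) by (simp add: gderiv_def)
  then have grad: "gradient \<Phi> = \<Gamma>"
    by (intro ext gradient_eqI)
  then show "gradient (\<lambda>x. \<Sum>n. \<phi> n x) = (\<lambda>x. \<Sum>n. G n x)"
    by (simp add: \<Phi>_def \<Gamma>_def)
  have "continuous_on UNIV \<Gamma>"
    using partial by (intro uniform_limit_theorem[OF _ uG]) (auto simp: test_function_def)
  then have "\<Phi> \<in> C1 \<Omega>"
    using D by (auto simp: C1_def grad gderiv_def differentiable_def intro: continuous_on_subset)
  moreover have "\<exists>\<psi>\<in>C1c \<Omega>. C1_norm \<Omega> (\<lambda>x. \<Phi> x - \<psi> x) < ennreal \<delta>" if "\<delta> > 0" for \<delta>
  proof -
    have "\<delta> / 3 > 0" using that by simp
    note ev = eventually_conj[OF uniform_limitD[OF u\<phi> this] uniform_limitD[OF uG this]]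
    obtain n where n: "\<And>x. dist (\<Sum>i<n. \<phi> i x) (\<Phi> x) < \<delta> / 3" "\<And>x. dist (\<Sum>i<n. G i x) (\<Gamma> x) < \<delta> / 3"
      using eventually_happens'[OF sequentially_bot ev] by blast
    have "GDERIV (\<lambda>x. \<Phi> x - (\<Sum>i<n. \<phi> i x)) x :> \<Gamma> x - (\<Sum>i<n. G i x)" for x
      using D partial by (intro GDERIV_diff) (auto simp: test_function_def)
    then have grad': "gradient (\<lambda>x. \<Phi> x - (\<Sum>i<n. \<phi> i x)) = (\<lambda>x. \<Gamma> x - (\<Sum>i<n. G i x))"
      by (intro ext gradient_eqI)
    have "C1_norm \<Omega> (\<lambda>x. \<Phi> x - (\<Sum>i<n. \<phi> i x)) \<le> ennreal (\<delta> / 3) + ennreal (\<delta> / 3)"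
      unfolding C1_norm_def grad' using n
      by (intro add_mono SUP_least ennreal_leI) (auto simp: dist_norm norm_minus_commute less_imp_le abs_minus_commute)
    also have "\<dots> < ennreal \<delta>"
      using that by (simp add: ennreal_plus[symmetric] ennreal_less_iff del: ennreal_plus)
    finally show ?thesis
      by (rule bexI[OF _ test_function_C1c(1)[OF partial]])
  qed
  ultimately show "(\<lambda>x. \<Sum>n. \<phi> n x) \<in> C1_0 \<Omega>"
    unfolding C1_0_def \<Phi>_def by blast
qed

section \<open>Lusin's theorem for Borel functions\<close>

text \<open>
  Closed inner approximation is truncated by large balls; finiteness of the measure makes the part
  outside them arbitrarily small.
\<close>

lemma lmeasurable_inner_compact:
  fixes S :: "'a::euclidean_space set"
  assumes "S \<in> lmeasurable" "e > 0"
  obtains K where "compact K" "K \<subseteq> S" "measure lebesgue (S - K) < e"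
proof -
  obtain T where T: "closed T" "T \<subseteq> S" "S - T \<in> lmeasurable" "emeasure lebesgue (S - T) < ennreal (e/2)"
    using sets_lebesgue_inner_closed[of S "e/2"] assms by auto
  have mT: "T \<in> lmeasurable"
    using assms T by (metis Diff_Diff_Int fmeasurable.Diff inf.absorb2)
  have ST: "measure lebesgue (S - T) < e / 2"
    using T(3,4) assms(2) by (simp add: emeasure_eq_measure2 ennreal_less_iff)
  have "(\<lambda>n. measure lebesgue (T \<inter> cball 0 (real n))) \<longlonglongrightarrow> measure lebesgue (\<Union>n. T \<inter> cball 0 (real n))"
  proof (rule Lim_measure_incseq)
    show "range (\<lambda>n. T \<inter> cball 0 (real n)) \<subseteq> sets lebesgue"
      using mT by auto
    show "incseq (\<lambda>n. T \<inter> cball 0 (real n))"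
      by (auto simp: incseq_def)
    have "emeasure lebesgue (\<Union>n. T \<inter> cball 0 (real n)) \<le> emeasure lebesgue T"
      using mT by (intro emeasure_mono) auto
    then show "emeasure lebesgue (\<Union>n. T \<inter> cball 0 (real n)) \<noteq> \<infinity>"
      using mT by (auto simp: fmeasurable_def top_unique)
  qed
  moreover have "(\<Union>n. T \<inter> cball 0 (real n)) = T"
    using real_arch_simple by fastforce
  ultimately have "\<forall>\<^sub>F n in sequentially. measure lebesgue (T \<inter> cball 0 (real n)) > measure lebesgue T - e/2"
    using assms(2) by (intro order_tendstoD) auto
  then obtain n where n: "measure lebesgue (T \<inter> cball 0 (real n)) > measure lebesgue T - e/2"
    by (auto dest: eventually_happens)
  have mK: "T \<inter> cball 0 (real n) \<in> lmeasurable"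
    using mT by (intro fmeasurable_Int_fmeasurable) auto
  show thesis
  proof
    show "compact (T \<inter> cball 0 (real n))"
      using T(1) by (simp add: closed_Int_compact)
    show "T \<inter> cball 0 (real n) \<subseteq> S" using T by auto
    have "measure lebesgue (S - (T \<inter> cball 0 (real n))) = measure lebesgue S - measure lebesgue (T \<inter> cball 0 (real n))"
      using assms mK T by (intro measurable_measure_Diff) auto
    also have "measure lebesgue S = measure lebesgue (S - T) + measure lebesgue T"
      using measurable_measure_Diff[OF assms(1), of T] mT T by auto
    finally show "measure lebesgue (S - (T \<inter> cball 0 (real n))) < e"
      using ST n by simp
  qed
qed

text \<open>
  The preimages of the sets of a countable base are enlarged to open sets, at a total cost of
  \<open>e / 2\<close>. Off the union of the differences, preimages of open sets are relatively open, so the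
  restriction of \<open>v\<close> is continuous there; the other half of \<open>e\<close> pays for compactness.
\<close>

lemma Lusin_continuous_on_compact:
  fixes \<Omega> :: "'a::euclidean_space set" and v :: "'a \<Rightarrow> 'b::euclidean_space"
  assumes "\<Omega> \<in> sets borel" "\<Omega> \<in> lmeasurable" "v \<in> borel_measurable (restrict_space borel \<Omega>)" "e > 0"
  obtains K where "compact K" "K \<subseteq> \<Omega>" "measure lebesgue (\<Omega> - K) < e" "continuous_on K v"
proof -
  obtain B :: "nat \<Rightarrow> 'b set" where "inj B" and B: "\<And>n. open (B n)" "\<And>W. open W \<Longrightarrow> \<exists>k. W = \<Union>{B n |n. n \<in> k}"
    by (rule univ_second_countable_sequence[where 'a='b]) (rule that)
  define E where "E n = \<Omega> \<inter> v -` B n" for n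
  have E: "E n \<in> sets lebesgue" for n
  proof -
    have "v -` B n \<inter> space (restrict_space borel \<Omega>) \<in> sets (restrict_space borel \<Omega>)"
      using assms(3) B(1) by (intro measurable_sets[where A=borel]) auto
    then have "E n \<in> sets borel"
      using assms(1) by (auto simp: sets_restrict_space_iff E_def space_restrict_space Int_commute)
    then show ?thesis by auto
  qed
  define d where "d n = e / 2 * (1/2) ^ Suc n" for n
  have d: "d n > 0" for n using assms(4) by (simp add: d_def)
  have "\<exists>U. open U \<and> E n \<subseteq> U \<and> U - E n \<in> lmeasurable \<and> emeasure lebesgue (U - E n) < ennreal (d n)" for n
    using sets_lebesgue_outer_open[OF E d] by metis
  then obtain U where U: "\<And>n. open (U n)" "\<And>n. E n \<subseteq> U n" "\<And>n. U n - E n \<in> lmeasurable"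
    "\<And>n. emeasure lebesgue (U n - E n) < ennreal (d n)" by metis
  define A where "A = (\<Union>n. U n - E n)"
  have "d sums (e / 2 * 1)"
    unfolding d_def by (intro sums_mult power_half_series)
  then have sd: "summable d" "suminf d = e / 2"
    by (auto simp: sums_iff)
  have "emeasure lebesgue A \<le> (\<Sum>n. emeasure lebesgue (U n - E n))"
    unfolding A_def using U(3) by (intro emeasure_subadditive_countably) auto
  also have "\<dots> \<le> (\<Sum>n. ennreal (d n))"
    using U(4) by (intro suminf_le) (auto simp: less_imp_le)
  also have "\<dots> = ennreal (e / 2)"
    using d sd by (subst suminf_ennreal2) (auto simp: less_imp_le)
  finally have emA: "emeasure lebesgue A \<le> ennreal (e / 2)" .
  have Asets: "A \<in> sets lebesgue"
    unfolding A_def using U(3) by auto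
  have mA: "A \<in> lmeasurable"
    using emA Asets by (intro fmeasurableI) (auto intro: le_less_trans)
  have A: "measure lebesgue A \<le> e / 2"
    using emA mA assms(4) by (simp add: emeasure_eq_measure2)
  define S where "S = \<Omega> - A"
  have mS: "S \<in> lmeasurable"
    unfolding S_def using assms mA by (intro fmeasurable.Diff) auto
  obtain K where K: "compact K" "K \<subseteq> S" "measure lebesgue (S - K) < e / 2"
    using lmeasurable_inner_compact[OF mS, of "e/2"] assms(4) by auto
  have "continuous_on S v"
    unfolding continuous_on_open_invariant
  proof (intro allI impI)
    fix W :: "'b set" assume "open W"
    then obtain k where k: "W = \<Union>{B n |n. n \<in> k}" using B(2) by blast
    have "S \<inter> U n = S \<inter> E n" for n
      using U(2) by (auto simp: S_def A_def)
    then have "(\<Union>n\<in>k. U n) \<inter> S = v -` W \<inter> S"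
      unfolding k by (auto simp: E_def S_def)
    then show "\<exists>V. open V \<and> V \<inter> S = v -` W \<inter> S"
      using U(1) by (intro exI[of _ "\<Union>n\<in>k. U n"]) auto
  qed
  show thesis
  proof
    show "compact K" by fact
    show "K \<subseteq> \<Omega>" using K by (auto simp: S_def)
    show "continuous_on K v" using \<open>continuous_on S v\<close> K(2) by (rule continuous_on_subset)
    have mSK: "S - K \<in> lmeasurable"
      using mS K by (intro fmeasurable.Diff) (auto simp: lmeasurable_compact)
    have "measure lebesgue (\<Omega> - K) \<le> measure lebesgue ((S - K) \<union> A)"
      using mSK mA assms K
      by (intro measure_mono_fmeasurable) (auto simp: S_def intro: fmeasurableD lmeasurable_compact)
    also have "\<dots> \<le> measure lebesgue (S - K) + measure lebesgue A"
      using mSK mA by (intro measure_Un_le) auto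
    finally show "measure lebesgue (\<Omega> - K) < e"
      using K A by simp
  qed
qed

section \<open>Approximation by the gradient of a sum of bumps\<close>

text \<open>
  Since the balls are disjoint, the volume of the union scales like that of a single ball.
\<close>

lemma measure_shrunken_balls:
  fixes F :: "('a::euclidean_space \<times> real) set"
  assumes "finite F" "\<And>i. i \<in> F \<Longrightarrow> snd i > 0" "0 < \<rho>" "\<rho> < 1"
    and disj: "pairwise (\<lambda>i j. disjnt (ball (fst i) (snd i)) (ball (fst j) (snd j))) F"
  shows "\<rho> ^ DIM('a) * measure lebesgue (\<Union>i\<in>F. ball (fst i) (snd i))
    \<le> measure lebesgue (\<Union>i\<in>F. cball (fst i) (\<rho> * snd i))"
proof -
  have sub: "cball (fst i) (\<rho> * snd i) \<subseteq> ball (fst i) (snd i)" if "i \<in> F" for i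
    using assms(2)[OF that] assms(3,4) by (simp add: cball_subset_ball_iff)
  have "\<rho> ^ DIM('a) * measure lebesgue (\<Union>i\<in>F. ball (fst i) (snd i))
    \<le> \<rho> ^ DIM('a) * (\<Sum>i\<in>F. measure lebesgue (ball (fst i) (snd i)))"
    using assms(1,3) by (intro mult_left_mono measure_UNION_le) auto
  also have "\<dots> = (\<Sum>i\<in>F. measure lebesgue (cball (fst i) (\<rho> * snd i)))"
    unfolding sum_distrib_left
  proof (rule sum.cong[OF refl])
    fix i assume "i \<in> F"
    then show "\<rho> ^ DIM('a) * measure lebesgue (ball (fst i) (snd i))
      = measure lebesgue (cball (fst i) (\<rho> * snd i))"
      using assms(2)[of i] assms(3) by (simp add: content_ball content_cball power_mult_distrib)
  qed
  also have "\<dots> = measure lebesgue (\<Union>i\<in>F. cball (fst i) (\<rho> * snd i))"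
  proof (rule measure_finite_Union[symmetric])
    show "disjoint_family_on (\<lambda>i. cball (fst i) (\<rho> * snd i)) F"
      using disj sub unfolding disjoint_family_on_def pairwise_def disjnt_def by blast
    show "emeasure lebesgue (cball (fst i) (\<rho> * snd i)) \<noteq> \<infinity>" for i
      using lmeasurable_cball[of "fst i" "\<rho> * snd i"] by (auto simp: fmeasurable_def)
  qed (use assms(1) in auto)
  finally show ?thesis .
qed

text \<open>
  Vitali's theorem covers \<open>\<Omega>\<close> up to a null set by countably many disjoint balls; since \<open>\<Omega>\<close> has
  finite measure, finitely many of them already fill the fraction \<open>\<rho> < 1\<close>.
\<close>

lemma Vitali_finite_balls:
  fixes \<Omega> :: "'a::euclidean_space set"
  assumes "\<Omega> \<in> lmeasurable" "\<rho> < 1"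
    and sub: "\<And>a r. (a, r) \<in> I \<Longrightarrow> 0 < r \<and> cball a r \<subseteq> \<Omega>"
    and fine: "\<And>x d. x \<in> \<Omega> \<Longrightarrow> 0 < d \<Longrightarrow> \<exists>r<d. (x, r) \<in> I"
  obtains F where "finite F" "F \<subseteq> I"
    "pairwise (\<lambda>i j. disjnt (ball (fst i) (snd i)) (ball (fst j) (snd j))) F"
    "\<rho> * measure lebesgue \<Omega> \<le> measure lebesgue (\<Union>i\<in>F. ball (fst i) (snd i))"
proof -
  define m where "m = measure lebesgue \<Omega>"
  have ex: "\<exists>i. i \<in> I \<and> x \<in> ball (fst i) (snd i) \<and> snd i < d" if "x \<in> \<Omega>" "0 < d" for x d
  proof -
    obtain r where "r < d" "(x, r) \<in> I" using fine[OF \<open>x \<in> \<Omega>\<close> \<open>0 < d\<close>] by blast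
    then show ?thesis using sub[of x r] by (intro exI[of _ "(x, r)"]) auto
  qed
  obtain C where C: "countable C" "C \<subseteq> I"
    "pairwise (\<lambda>i j. disjnt (ball (fst i) (snd i)) (ball (fst j) (snd j))) C"
    "negligible (\<Omega> - (\<Union>i\<in>C. ball (fst i) (snd i)))"
    by (rule Vitali_covering_theorem_balls[OF ex])
  show thesis
  proof (cases "m = 0")
    case True
    then show thesis by (intro that[of "{}"]) (auto simp: m_def)
  next
    case False
    then have "m > 0" by (simp add: m_def zero_less_measure_iff)
    have "C \<noteq> {}"
    proof
      assume "C = {}"
      then have "negligible \<Omega>" using C(4) by simp
      then show False using False by (simp add: m_def negligible_imp_measure0)
    qed
    define c where "c = from_nat_into C"
    have rc: "range c = C" using C(1) \<open>C \<noteq> {}\<close> by (simp add: c_def range_from_nat_into)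
    define D where "D n = (\<Union>i\<in>c ` {..n}. ball (fst i) (snd i))" for n :: nat
    have DC: "(\<Union>n. D n) = (\<Union>i\<in>C. ball (fst i) (snd i))"
      unfolding D_def rc[symmetric] by auto
    have D\<Omega>: "(\<Union>n. D n) \<subseteq> \<Omega>"
      unfolding DC
    proof (rule UN_least)
      fix i assume "i \<in> C"
      then show "ball (fst i) (snd i) \<subseteq> \<Omega>"
        using C(2) sub[of "fst i" "snd i"] ball_subset_cball[of "fst i" "snd i"] by force
    qed
    have neg: "negligible (\<Omega> - (\<Union>n. D n))"
      using C(4) unfolding DC .
    have meq: "measure lebesgue (\<Union>n. D n) = m"
    proof -
      have sym: "sym_diff \<Omega> (\<Union>n. D n) = \<Omega> - (\<Union>n. D n)" using D\<Omega> by blast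
      have "measure lebesgue (\<Union>n. D n) = measure lebesgue \<Omega>"
        by (rule measure_negligible_symdiff) (use assms(1) neg sym in auto)
      then show ?thesis by (simp add: m_def)
    qed
    have "(\<lambda>n. measure lebesgue (D n)) \<longlonglongrightarrow> measure lebesgue (\<Union>n. D n)"
    proof (rule Lim_measure_incseq)
      show "range D \<subseteq> sets lebesgue" by (auto simp: D_def)
      show "incseq D"
        unfolding incseq_def D_def by (intro allI impI UN_mono image_mono) auto
      have "emeasure lebesgue (\<Union>n. D n) \<le> emeasure lebesgue \<Omega>"
        using D\<Omega> assms(1) by (intro emeasure_mono) auto
      then show "emeasure lebesgue (\<Union>n. D n) \<noteq> \<infinity>"
        using assms(1) by (auto simp: fmeasurable_def top_unique)
    qed
    moreover have "\<rho> * m < m" using \<open>m > 0\<close> assms(2) by simp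
    ultimately have "\<forall>\<^sub>F n in sequentially. \<rho> * m < measure lebesgue (D n)"
      unfolding meq by (intro order_tendstoD)
    then obtain n where n: "\<rho> * m < measure lebesgue (D n)"
      by (auto dest: eventually_happens)
    show thesis
    proof (rule that[of "c ` {..n}"])
      show "c ` {..n} \<subseteq> I" using rc C(2) by blast
      show "pairwise (\<lambda>i j. disjnt (ball (fst i) (snd i)) (ball (fst j) (snd j))) (c ` {..n})"
        using C(3) rc by (auto intro: pairwise_subset)
      show "\<rho> * measure lebesgue \<Omega> \<le> measure lebesgue (\<Union>i\<in>c ` {..n}. ball (fst i) (snd i))"
        using n by (simp add: m_def D_def)
    qed simp
  qed
qed

text \<open>
  One factor \<open>\<rho>\<close> in the measure is lost by keeping only finitely many balls, the others by shrinking
  them. At each point at most one bump is nonzero, so the bounds for a single bump pass to the sum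
  and do not depend on the number of balls.
\<close>

lemma gradient_approximation_on_balls:
  fixes \<Omega> :: "'a::euclidean_space set" and v :: "'a \<Rightarrow> 'a"
  assumes "open \<Omega>" "\<Omega> \<in> lmeasurable" "continuous_on \<Omega> v" "\<And>x. x \<in> \<Omega> \<Longrightarrow> norm (v x) \<le> M" "0 \<le> M"
    and "0 < \<rho>" "\<rho> < 1" "\<eta> > 0"
  obtains K \<phi> G where "compact K" "K \<subseteq> \<Omega>" "\<rho> ^ Suc (DIM('a)) * measure lebesgue \<Omega> \<le> measure lebesgue K"
    "test_function \<Omega> \<phi> G" "\<And>x. \<bar>\<phi> x\<bar> \<le> \<eta>" "\<And>x. norm (G x) \<le> (1 + 8 / (1 - \<rho>\<^sup>2)) * M"
    "\<And>x. x \<in> K \<Longrightarrow> norm (v x - G x) \<le> \<eta>"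
proof -
  define c where "c = 1 + 8 / (1 - \<rho>\<^sup>2)"
  have "\<rho>\<^sup>2 < 1" using assms by (simp add: power_less_one_iff)
  then have "c \<ge> 0" by (simp add: c_def)
  define I where "I = {(a, r). 0 < r \<and> cball a r \<subseteq> \<Omega> \<and> r * M \<le> \<eta> \<and> (\<forall>x\<in>cball a r. norm (v x - v a) \<le> \<eta>)}"
  have fine: "\<exists>r<d. (a, r) \<in> I" if a: "a \<in> \<Omega>" and "0 < d" for a d
  proof -
    obtain r1 where r1: "r1 > 0" "ball a r1 \<subseteq> \<Omega>"
      using assms(1) a openE by blast
    obtain r2 where r2: "r2 > 0" "\<And>x. x \<in> \<Omega> \<Longrightarrow> dist x a < r2 \<Longrightarrow> dist (v x) (v a) \<le> \<eta>"
      using assms(3,8) a unfolding continuous_on_iff by (meson less_imp_le)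
    \<comment> \<open>Adding 1 to \<open>M\<close> keeps the quotient meaningful for \<open>M = 0\<close>.\<close>
    define r0 where "r0 = min (min r1 r2) (min d (\<eta> / (M + 1)))"
    define r where "r = r0 / 2"
    have "\<eta> / (M + 1) > 0" using assms by simp
    then have "r0 > 0" using r1 r2 \<open>0 < d\<close> by (simp add: r0_def)
    moreover have "r0 \<le> r1" "r0 \<le> r2" "r0 \<le> d" "r0 \<le> \<eta> / (M + 1)"
      unfolding r0_def by auto
    ultimately have r: "r > 0" "r < r1" "r < r2" "r < d" "r < \<eta> / (M + 1)"
      unfolding r_def by linarith+
    have "r * (M + 1) \<le> \<eta>" using r(5) assms(5) by (simp add: field_simps)
    then have "r * M \<le> \<eta>" using r(1) by (simp add: ring_distribs)
    moreover have sub: "cball a r \<subseteq> \<Omega>" using r r1 by auto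
    moreover have "norm (v x - v a) \<le> \<eta>" if "x \<in> cball a r" for x
      using r2(2)[of x] that sub r by (auto simp: dist_norm norm_minus_commute)
    ultimately show ?thesis using r by (auto simp: I_def)
  qed
  obtain F where F: "finite F" "F \<subseteq> I"
    "pairwise (\<lambda>i j. disjnt (ball (fst i) (snd i)) (ball (fst j) (snd j))) F"
    "\<rho> * measure lebesgue \<Omega> \<le> measure lebesgue (\<Union>i\<in>F. ball (fst i) (snd i))"
    by (rule Vitali_finite_balls[OF assms(2,7) _ fine]) (auto simp: I_def)
  have FI: "0 < snd i" "cball (fst i) (snd i) \<subseteq> \<Omega>" "snd i * M \<le> \<eta>"
    "\<And>x. x \<in> cball (fst i) (snd i) \<Longrightarrow> norm (v x - v (fst i)) \<le> \<eta>" "fst i \<in> \<Omega>" if "i \<in> F" for i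
  proof -
    have "(fst i, snd i) \<in> I" using that F(2) by auto
    then show "0 < snd i" "cball (fst i) (snd i) \<subseteq> \<Omega>" "snd i * M \<le> \<eta>"
      "\<And>x. x \<in> cball (fst i) (snd i) \<Longrightarrow> norm (v x - v (fst i)) \<le> \<eta>"
      by (auto simp only: I_def mem_Collect_eq prod.case)
    then show "fst i \<in> \<Omega>" by (meson centre_in_cball less_imp_le subsetD)
  qed
  define bump where "bump i \<phi> G \<longleftrightarrow> (\<forall>x. GDERIV \<phi> x :> G x) \<and> continuous_on UNIV G \<and>
     (\<forall>x. \<bar>\<phi> x\<bar> \<le> \<eta>) \<and> (\<forall>x. norm (G x) \<le> c * M) \<and>
     (\<forall>x. x \<notin> ball (fst i) (snd i) \<longrightarrow> \<phi> x = 0 \<and> G x = 0) \<and>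
     (\<forall>x\<in>cball (fst i) (\<rho> * snd i). G x = v (fst i))" for i \<phi> G
  have "\<exists>\<phi> G. bump i \<phi> G" if i: "i \<in> F" for i
  proof -
    obtain \<phi> G where *: "\<And>x. GDERIV \<phi> x :> G x" "continuous_on UNIV G"
      "\<And>x. \<bar>\<phi> x\<bar> \<le> snd i * norm (v (fst i))" "\<And>x. norm (G x) \<le> c * norm (v (fst i))"
      "\<And>x. x \<notin> ball (fst i) (snd i) \<Longrightarrow> \<phi> x = 0 \<and> G x = 0"
      "\<And>x. x \<in> cball (fst i) (\<rho> * snd i) \<Longrightarrow> G x = v (fst i)"
      by (rule localized_linear_function[OF FI(1)[OF i] assms(6,7), where a = "fst i" and w = "v (fst i)", folded c_def]) (rule that)
    have vM: "norm (v (fst i)) \<le> M" using assms(4) FI(5)[OF i] .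
    have "snd i * norm (v (fst i)) \<le> snd i * M" "c * norm (v (fst i)) \<le> c * M"
      using vM FI(1)[OF i] \<open>c \<ge> 0\<close> by (auto intro!: mult_left_mono)
    then have "\<bar>\<phi> x\<bar> \<le> \<eta>" "norm (G x) \<le> c * M" for x
      using *(3)[of x] *(4)[of x] FI(3)[OF i] by linarith+
    then have "bump i \<phi> G" using * by (simp add: bump_def)
    then show ?thesis by blast
  qed
  then obtain \<phi> G where "\<And>i. i \<in> F \<Longrightarrow> bump i (\<phi> i) (G i)" by metis
  then have \<phi>G: "\<And>i x. i \<in> F \<Longrightarrow> GDERIV (\<phi> i) x :> G i x" "\<And>i. i \<in> F \<Longrightarrow> continuous_on UNIV (G i)"
    "\<And>i x. i \<in> F \<Longrightarrow> \<bar>\<phi> i x\<bar> \<le> \<eta>" "\<And>i x. i \<in> F \<Longrightarrow> norm (G i x) \<le> c * M"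
    "\<And>i x. i \<in> F \<Longrightarrow> x \<notin> ball (fst i) (snd i) \<Longrightarrow> \<phi> i x = 0 \<and> G i x = 0"
    "\<And>i x. i \<in> F \<Longrightarrow> x \<in> cball (fst i) (\<rho> * snd i) \<Longrightarrow> G i x = v (fst i)"
    by (simp_all add: bump_def)
  define \<Phi> where "\<Phi> x = (\<Sum>i\<in>F. \<phi> i x)" for x
  define \<Gamma> where "\<Gamma> x = (\<Sum>i\<in>F. G i x)" for x
  have at: "\<Phi> x = \<phi> i x \<and> \<Gamma> x = G i x" if i: "i \<in> F" and x: "x \<in> ball (fst i) (snd i)" for i x
  proof -
    have "\<phi> j x = 0 \<and> G j x = 0" if j: "j \<in> F - {i}" for j
    proof (rule \<phi>G(5))
      have "disjnt (ball (fst i) (snd i)) (ball (fst j) (snd j))"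
        using pairwiseD[OF F(3) i] j by blast
      then show "x \<notin> ball (fst j) (snd j)" using x by (meson disjnt_iff)
    qed (use j in simp)
    then show ?thesis
      unfolding \<Phi>_def \<Gamma>_def using F(1) i by (simp add: sum.remove)
  qed
  have off: "\<Phi> x = 0 \<and> \<Gamma> x = 0" if "x \<notin> (\<Union>i\<in>F. ball (fst i) (snd i))" for x
    using that \<phi>G(5) by (auto simp: \<Phi>_def \<Gamma>_def intro!: sum.neutral)
  define K where "K = (\<Union>i\<in>F. cball (fst i) (\<rho> * snd i))"
  have sub: "cball (fst i) (\<rho> * snd i) \<subseteq> ball (fst i) (snd i)" if "i \<in> F" for i
    using FI(1)[OF that] assms(6,7) by (simp add: cball_subset_ball_iff)
  show thesis
  proof
    show "compact K" unfolding K_def using F(1) by (intro compact_UN) auto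
    show "K \<subseteq> \<Omega>" unfolding K_def using sub FI(2) ball_subset_cball by blast
    have "\<rho> ^ Suc (DIM('a)) * measure lebesgue \<Omega> = \<rho> ^ DIM('a) * (\<rho> * measure lebesgue \<Omega>)" by simp
    also have "\<dots> \<le> \<rho> ^ DIM('a) * measure lebesgue (\<Union>i\<in>F. ball (fst i) (snd i))"
      using F(4) assms(6) by (intro mult_left_mono) auto
    also have "\<dots> \<le> measure lebesgue K"
      unfolding K_def using F FI assms(6,7) by (intro measure_shrunken_balls) auto
    finally show "\<rho> ^ Suc (DIM('a)) * measure lebesgue \<Omega> \<le> measure lebesgue K" .
    show "test_function \<Omega> \<Phi> \<Gamma>"
      unfolding \<Phi>_def \<Gamma>_def
    proof (rule test_function_sum[OF F(1)])
      fix i assume i: "i \<in> F"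
      then show "test_function \<Omega> (\<phi> i) (G i)"
        unfolding test_function_def using \<phi>G FI(2)[OF i]
        by (intro conjI allI exI[of _ "cball (fst i) (snd i)"]) (auto simp: not_le)
    qed
    fix x
    show "\<bar>\<Phi> x\<bar> \<le> \<eta>"
      using at off \<phi>G(3) assms(8) by (cases "x \<in> (\<Union>i\<in>F. ball (fst i) (snd i))") auto
    show "norm (\<Gamma> x) \<le> (1 + 8 / (1 - \<rho>\<^sup>2)) * M"
      unfolding c_def[symmetric]
      using at off \<phi>G(4) assms(5) \<open>c \<ge> 0\<close> by (cases "x \<in> (\<Union>i\<in>F. ball (fst i) (snd i))") auto
    assume "x \<in> K"
    then obtain i where i: "i \<in> F" "x \<in> cball (fst i) (\<rho> * snd i)" by (auto simp: K_def)
    then have "\<Gamma> x = v (fst i)" using at sub \<phi>G(6) by (metis subsetD)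
    then show "norm (v x - \<Gamma> x) \<le> \<eta>"
      using FI(4)[OF i(1)] i sub[OF i(1)] ball_subset_cball by force
  qed
qed

text \<open>
  The same step with the loss of measure \<open>\<delta>\<close> as the parameter. The order of the quantifiers matters:
  \<open>c\<close> depends on \<open>\<Omega>\<close> and \<open>\<delta>\<close> only, so in an iteration it is known before the field is.
\<close>

lemma gradient_approximation:
  fixes \<Omega> :: "'a::euclidean_space set"
  assumes "open \<Omega>" "\<Omega> \<in> lmeasurable" "\<delta> > 0"
  shows "\<exists>c\<ge>1. \<forall>v M \<eta>. continuous_on \<Omega> v \<longrightarrow> (\<forall>x\<in>\<Omega>. norm (v x) \<le> M) \<longrightarrow> 0 \<le> M \<longrightarrow> \<eta> > 0 \<longrightarrow>
    (\<exists>K \<phi> G. compact K \<and> K \<subseteq> \<Omega> \<and> measure lebesgue (\<Omega> - K) \<le> \<delta> * measure lebesgue \<Omega> \<and>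
      test_function \<Omega> \<phi> G \<and> (\<forall>x. \<bar>\<phi> x\<bar> \<le> \<eta>) \<and> (\<forall>x. norm (G x) \<le> c * M) \<and>
      (\<forall>x\<in>K. norm (v x - G x) \<le> \<eta>))"
proof -
  define d where "d = real (Suc (DIM('a)))"
  define t where "t = min (1/2) (\<delta> / d)"
  have "d > 0" by (simp add: d_def)
  have t: "0 < t" "t \<le> 1/2" "d * t \<le> \<delta>"
    using assms(3) \<open>d > 0\<close> by (auto simp: t_def min_def field_simps)
  define \<rho> where "\<rho> = 1 - t"
  have \<rho>: "0 < \<rho>" "\<rho> < 1" using t by (auto simp: \<rho>_def)
  \<comment> \<open>Bernoulli's inequality turns the loss \<open>t\<close> per factor \<open>\<rho>\<close> into a total loss of at most \<open>d * t\<close>.\<close>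
  have "1 + d * (- t) \<le> (1 + (- t)) ^ Suc (DIM('a))"
    unfolding d_def using t by (intro Bernoulli_inequality) auto
  then have pow: "1 - \<delta> \<le> \<rho> ^ Suc (DIM('a))"
    using t(3) by (simp add: \<rho>_def)
  show ?thesis
  proof (intro exI[of _ "1 + 8 / (1 - \<rho>\<^sup>2)"] conjI allI impI)
    have "\<rho>\<^sup>2 < 1" using \<rho> by (simp add: power_less_one_iff)
    then show "1 + 8 / (1 - \<rho>\<^sup>2) \<ge> 1" by simp
    fix v :: "'a \<Rightarrow> 'a" and M \<eta> :: real
    assume v: "continuous_on \<Omega> v" "\<forall>x\<in>\<Omega>. norm (v x) \<le> M" "0 \<le> M" and "\<eta> > 0"
    obtain K \<phi> G where K: "compact K" "K \<subseteq> \<Omega>"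
      "\<rho> ^ Suc (DIM('a)) * measure lebesgue \<Omega> \<le> measure lebesgue K"
      and \<phi>: "test_function \<Omega> \<phi> G" "\<And>x. \<bar>\<phi> x\<bar> \<le> \<eta>" "\<And>x. norm (G x) \<le> (1 + 8 / (1 - \<rho>\<^sup>2)) * M"
      "\<And>x. x \<in> K \<Longrightarrow> norm (v x - G x) \<le> \<eta>"
      by (rule gradient_approximation_on_balls[OF assms(1,2) v(1) bspec[OF v(2)] v(3) \<rho> \<open>\<eta> > 0\<close>])
        (assumption | rule that)+
    have "measure lebesgue (\<Omega> - K) = measure lebesgue \<Omega> - measure lebesgue K"
      using assms(2) K by (intro measurable_measure_Diff) (auto intro: fmeasurableD lmeasurable_compact)
    also have "\<dots> \<le> measure lebesgue \<Omega> - (1 - \<delta>) * measure lebesgue \<Omega>"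
      using K(3) mult_right_mono[OF pow, of "measure lebesgue \<Omega>"] by simp
    also have "\<dots> = \<delta> * measure lebesgue \<Omega>" by (simp add: ring_distribs)
    finally show "\<exists>K \<phi> G. compact K \<and> K \<subseteq> \<Omega> \<and> measure lebesgue (\<Omega> - K) \<le> \<delta> * measure lebesgue \<Omega> \<and>
        test_function \<Omega> \<phi> G \<and> (\<forall>x. \<bar>\<phi> x\<bar> \<le> \<eta>) \<and> (\<forall>x. norm (G x) \<le> (1 + 8 / (1 - \<rho>\<^sup>2)) * M) \<and>
        (\<forall>x\<in>K. norm (v x - G x) \<le> \<eta>)"
      using K \<phi> by blast
  qed
qed

section \<open>Iteration\<close>

text \<open>
  The iteration. Step \<open>n\<close> may lose the fraction \<open>\<delta>' n\<close> of the measure, which determines its constant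
  \<open>c n\<close>. The bound \<open>d n\<close> for the field treated in step \<open>n\<close> is chosen such that \<open>c n * d n = b n\<close>, with
  \<open>b n\<close> summable; the scale \<open>B\<close> is such that the given field satisfies the bound \<open>d 0\<close>.
\<close>

lemma Lusin_gradient_continuous:
  fixes \<Omega> :: "'a::euclidean_space set" and v :: "'a \<Rightarrow> 'a"
  assumes "open \<Omega>" "\<Omega> \<in> lmeasurable" "\<delta> > 0"
    and v: "continuous_on UNIV v" "\<And>x. norm (v x) \<le> M"
  obtains K \<phi> where "closed K" "K \<subseteq> \<Omega>" "emeasure lebesgue (\<Omega> - K) \<le> ennreal \<delta> * emeasure lebesgue \<Omega>"
    "\<phi> \<in> C1_0 \<Omega>" "\<And>x. x \<in> K \<Longrightarrow> v x = gradient \<phi> x"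
proof -
  define m where "m = measure lebesgue \<Omega>"
  have "0 \<le> M" using v(2)[of 0] norm_ge_zero order_trans by blast
  define \<delta>' where "\<delta>' n = \<delta> * (1/2) ^ Suc n" for n
  have \<delta>': "\<delta>' n > 0" for n using assms(3) by (simp add: \<delta>'_def)
  have "\<exists>c\<ge>1. \<forall>v M \<eta>. continuous_on \<Omega> v \<longrightarrow> (\<forall>x\<in>\<Omega>. norm (v x) \<le> M) \<longrightarrow> 0 \<le> M \<longrightarrow> \<eta> > 0 \<longrightarrow>
      (\<exists>K \<phi> G. compact K \<and> K \<subseteq> \<Omega> \<and> measure lebesgue (\<Omega> - K) \<le> \<delta>' n * m \<and>
        test_function \<Omega> \<phi> G \<and> (\<forall>x. \<bar>\<phi> x\<bar> \<le> \<eta>) \<and> (\<forall>x. norm (G x) \<le> c * M) \<and>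
        (\<forall>x\<in>K. norm (v x - G x) \<le> \<eta>))" for n
    unfolding m_def by (rule gradient_approximation[OF assms(1,2) \<delta>'[of n]])
  then obtain c :: "nat \<Rightarrow> real" where c1: "\<And>n. c n \<ge> 1"
    and approx: "\<And>n v M \<eta>. continuous_on \<Omega> v \<Longrightarrow> (\<forall>x\<in>\<Omega>. norm (v x) \<le> M) \<Longrightarrow> 0 \<le> M \<Longrightarrow> \<eta> > 0 \<Longrightarrow>
      \<exists>K \<phi> G. compact K \<and> K \<subseteq> \<Omega> \<and> measure lebesgue (\<Omega> - K) \<le> \<delta>' n * m \<and>
        test_function \<Omega> \<phi> G \<and> (\<forall>x. \<bar>\<phi> x\<bar> \<le> \<eta>) \<and> (\<forall>x. norm (G x) \<le> c n * M) \<and>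
        (\<forall>x\<in>K. norm (v x - G x) \<le> \<eta>)"
    by metis
  have c: "c n > 0" for n using c1[of n] by simp
  define B where "B = c 0 * (M + 1)"
  define b where "b n = B * (1/2) ^ n" for n
  define d where "d n = b n / c n" for n
  have "B > 0" using c[of 0] \<open>0 \<le> M\<close> by (simp add: B_def)
  then have b: "b n > 0" for n by (simp add: b_def)
  then have d: "d n > 0" for n using c[of n] by (simp add: d_def)
  have cd: "c n * d n = b n" for n using c[of n] by (simp add: d_def)
  have d0: "d 0 = M + 1" using c[of 0] by (simp add: d_def b_def B_def)
  define P where "P n w \<longleftrightarrow> continuous_on UNIV w \<and> (\<forall>x. norm (w x) \<le> d n)" for n and w :: "'a \<Rightarrow> 'a"
  \<comment> \<open>\<open>R n w w'\<close> expresses that \<open>w'\<close> continues, on the compact set of step \<open>n\<close>, the error that this step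
    leaves for the field \<open>w\<close>.\<close>
  define R where "R n w w' K \<phi> G \<longleftrightarrow> compact K \<and> K \<subseteq> \<Omega> \<and> measure lebesgue (\<Omega> - K) \<le> \<delta>' n * m \<and>
        test_function \<Omega> \<phi> G \<and> (\<forall>x. \<bar>\<phi> x\<bar> \<le> b n) \<and> (\<forall>x. norm (G x) \<le> b n) \<and>
        (\<forall>x\<in>K. w' x = w x - G x)" for n and w w' :: "'a \<Rightarrow> 'a" and K \<phi> G
  have "\<exists>f. \<forall>n. P n (f n) \<and> (\<exists>K \<phi> G. R n (f n) (f (Suc n)) K \<phi> G) \<and> (n = 0 \<longrightarrow> f n = v)"
  proof -
    have "\<exists>f. \<forall>n. (P n (f n) \<and> (n = 0 \<longrightarrow> f n = v)) \<and> (\<exists>K \<phi> G. R n (f n) (f (Suc n)) K \<phi> G)"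
    proof (rule dependent_nat_choice)
      have "norm (v x) \<le> d 0" for x using v(2)[of x] d0 by simp
      then show "\<exists>w. P 0 w \<and> (0 = (0::nat) \<longrightarrow> w = v)"
        using v(1) by (intro exI[of _ v]) (auto simp: P_def)
    next
      fix w n assume "P n w \<and> (n = 0 \<longrightarrow> w = v)"
      then have w: "continuous_on UNIV w" "\<And>x. norm (w x) \<le> d n" by (auto simp: P_def)
      \<comment> \<open>The first bound makes the series of functions converge, the second keeps the error within
        what the next step tolerates.\<close>
      define \<eta> where "\<eta> = min (b n) (d (Suc n))"
      have "\<eta> > 0" using b d by (simp add: \<eta>_def)
      have "continuous_on \<Omega> w" using w(1) continuous_on_subset by blast
      from approx[OF this _ less_imp_le[OF d[of n]] \<open>\<eta> > 0\<close>, of n] w(2)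
      obtain K \<phi> G where K: "compact K" "K \<subseteq> \<Omega>" "measure lebesgue (\<Omega> - K) \<le> \<delta>' n * m"
        and \<phi>: "test_function \<Omega> \<phi> G" "\<And>x. \<bar>\<phi> x\<bar> \<le> \<eta>" "\<And>x. norm (G x) \<le> c n * d n"
        and close: "\<And>x. x \<in> K \<Longrightarrow> norm (w x - G x) \<le> \<eta>"
        by blast
      have "continuous_on UNIV (\<lambda>x. w x - G x)"
        using w(1) \<phi>(1) by (intro continuous_on_diff) (auto simp: test_function_def)
      then have "continuous_on K (\<lambda>x. w x - G x)" using continuous_on_subset by blast
      then obtain w' where w': "continuous_on UNIV w'" "\<And>x. x \<in> K \<Longrightarrow> w' x = w x - G x"
        "\<And>x. x \<in> UNIV \<Longrightarrow> norm (w' x) \<le> \<eta>"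
        by (rule Tietze[where U=UNIV and B=\<eta>]) (use K(1) close \<open>\<eta> > 0\<close> in \<open>auto simp: compact_imp_closed\<close>)
      have "norm (w' x) \<le> d (Suc n)" for x
        using w'(3)[of x] by (simp add: \<eta>_def)
      then have "P (Suc n) w'" using w'(1) by (simp add: P_def)
      moreover have "\<bar>\<phi> x\<bar> \<le> b n" for x using \<phi>(2)[of x] by (simp add: \<eta>_def)
      then have "R n w w' K \<phi> G"
        using K \<phi> w'(2) by (simp add: R_def cd)
      ultimately show "\<exists>w'. (P (Suc n) w' \<and> (Suc n = 0 \<longrightarrow> w' = v)) \<and> (\<exists>K \<phi> G. R n w w' K \<phi> G)"
        by blast
    qed
    then show ?thesis by blast
  qed
  then obtain w where w: "\<And>n. P n (w n)" "\<And>n. \<exists>K \<phi> G. R n (w n) (w (Suc n)) K \<phi> G" "w 0 = v"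
    by blast
  then obtain K \<phi> G where R: "\<And>n. R n (w n) (w (Suc n)) (K n) (\<phi> n) (G n)"
    by metis
  have "summable b"
    unfolding b_def by (intro summable_mult summable_geometric) simp
  have series: "(\<lambda>x. \<Sum>n. \<phi> n x) \<in> C1_0 \<Omega>" "gradient (\<lambda>x. \<Sum>n. \<phi> n x) = (\<lambda>x. \<Sum>n. G n x)"
    using R by (auto simp: R_def intro!: C1_0_series[where b=b and G=G] \<open>summable b\<close>)
  show thesis
  proof
    show "closed (\<Inter>n. K n)"
      using R by (intro closed_INT) (auto simp: R_def compact_imp_closed)
    show "(\<Inter>n. K n) \<subseteq> \<Omega>" using R[of 0] by (auto simp: R_def)
    have sK: "\<Omega> - K n \<in> lmeasurable" for n
      using R[of n] assms(2) by (intro fmeasurable.Diff) (auto simp: R_def intro: fmeasurableD lmeasurable_compact)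
    have "\<delta>' sums (\<delta> * 1)"
      unfolding \<delta>'_def by (intro sums_mult power_half_series)
    then have "(\<lambda>n. \<delta>' n * m) sums (\<delta> * 1 * m)" by (rule sums_mult2)
    then have s\<delta>: "summable (\<lambda>n. \<delta>' n * m)" "(\<Sum>n. \<delta>' n * m) = \<delta> * m"
      by (auto simp: sums_iff)
    have "emeasure lebesgue (\<Omega> - (\<Inter>n. K n)) = emeasure lebesgue (\<Union>n. \<Omega> - K n)"
      by (rule arg_cong[where f="emeasure lebesgue"]) auto
    also have "\<dots> \<le> (\<Sum>n. emeasure lebesgue (\<Omega> - K n))"
      using sK by (intro emeasure_subadditive_countably) auto
    also have "\<dots> \<le> (\<Sum>n. ennreal (\<delta>' n * m))"
      using R sK by (intro suminf_le) (auto simp: R_def emeasure_eq_measure2 intro!: ennreal_leI)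
    also have "\<dots> = ennreal (\<delta> * m)"
      using \<delta>' s\<delta> by (subst suminf_ennreal2) (auto simp: m_def less_imp_le)
    also have "\<dots> = ennreal \<delta> * emeasure lebesgue \<Omega>"
      using assms(2,3) by (simp add: m_def emeasure_eq_measure2 flip: ennreal_mult)
    finally show "emeasure lebesgue (\<Omega> - (\<Inter>n. K n)) \<le> ennreal \<delta> * emeasure lebesgue \<Omega>" .
    show "(\<lambda>x. \<Sum>n. \<phi> n x) \<in> C1_0 \<Omega>" by (rule series)
    fix x assume x: "x \<in> (\<Inter>n. K n)"
    have tele: "(\<Sum>k<n. G k x) = v x - w n x" for n
      using x R by (induction n) (auto simp: w(3) R_def)
    have "(\<lambda>n. w n x) \<longlonglongrightarrow> 0"
    proof (rule Lim_null_comparison[OF always_eventually])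
      have "d n \<le> b n" for n
        using mult_right_mono[OF c1[of n] less_imp_le[OF d[of n]]] by (simp add: cd)
      then show "\<forall>n. norm (w n x) \<le> b n"
        using w(1) unfolding P_def by (meson order_trans)
      show "b \<longlonglongrightarrow> 0" using \<open>summable b\<close> by (rule summable_LIMSEQ_zero)
    qed
    from tendsto_diff[OF tendsto_const this, of "v x"]
    have "(\<lambda>n. G n x) sums v x" by (simp add: sums_def tele)
    then show "v x = gradient (\<lambda>x. \<Sum>n. \<phi> n x) x"
      by (simp add: series(2) sums_unique)
  qed
qed

section \<open>Borel vector fields\<close>

theorem theorem1p1:
  fixes \<Omega> :: "(real ^ 'n) set"
    and v :: "real ^ 'n \<Rightarrow> real ^ 'n"
    and \<epsilon> :: real
  assumes "CARD('n) \<ge> 2"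
    and "open \<Omega>"
    and "emeasure lebesgue \<Omega> < \<infinity>"
    and "v \<in> borel_measurable (restrict_space borel \<Omega>)"
    and "\<epsilon> > 0"
  shows "\<exists>A \<phi>. open A \<and> A \<subseteq> \<Omega> \<and> \<phi> \<in> C1_0 \<Omega> \<and>
    emeasure lebesgue A \<le> ennreal \<epsilon> * emeasure lebesgue \<Omega> \<and>
    (\<forall>x\<in>\<Omega> - A. v x = gradient \<phi> x)"
proof -
  have \<Omega>: "\<Omega> \<in> lmeasurable"
    using assms(2,3) by (intro fmeasurableI) auto
  have "\<epsilon> / 2 > 0" using assms(5) by simp
  \<comment> \<open>Lusin's theorem needs a positive tolerance, and \<open>\<epsilon> / 2\<close> times the measure is positive only for
    nonempty \<open>\<Omega>\<close>.\<close>
  obtain K where K: "closed K" "emeasure lebesgue (\<Omega> - K) \<le> ennreal (\<epsilon> / 2) * emeasure lebesgue \<Omega>"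
    and cont: "continuous_on K v" "bounded (v ` K)"
  proof (cases "\<Omega> = {}")
    case True
    then show thesis by (intro that[of "{}"]) auto
  next
    case False
    then have "measure lebesgue \<Omega> > 0"
      using assms(2) \<Omega> open_not_negligible negligible_iff_measure
      by (metis zero_less_measure_iff)
    then have "\<epsilon> / 2 * measure lebesgue \<Omega> > 0" using assms(5) by simp
    then obtain K where K: "compact K" "K \<subseteq> \<Omega>"
      "measure lebesgue (\<Omega> - K) < \<epsilon> / 2 * measure lebesgue \<Omega>" "continuous_on K v"
      using Lusin_continuous_on_compact[OF borel_open[OF assms(2)] \<Omega> assms(4)] by blast
    have "\<Omega> - K \<in> lmeasurable"
      using \<Omega> K(1) by (intro fmeasurable.Diff) (auto intro: fmeasurableD lmeasurable_compact)
    then have "emeasure lebesgue (\<Omega> - K) \<le> ennreal (\<epsilon> / 2 * measure lebesgue \<Omega>)"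
      using K(3) by (simp add: emeasure_eq_measure2 ennreal_leI)
    also have "\<dots> = ennreal (\<epsilon> / 2) * emeasure lebesgue \<Omega>"
      using \<Omega> assms(5) by (simp add: emeasure_eq_measure2 flip: ennreal_mult)
    finally show thesis
      using K by (intro that[of K]) (auto intro: compact_imp_closed compact_imp_bounded compact_continuous_image)
  qed
  obtain M where M: "0 < M" "\<And>x. x \<in> K \<Longrightarrow> norm (v x) \<le> M"
    using cont(2) unfolding bounded_pos by auto
  obtain w where w: "continuous_on UNIV w" "\<And>x. x \<in> K \<Longrightarrow> w x = v x" "\<And>x. x \<in> UNIV \<Longrightarrow> norm (w x) \<le> M"
    by (rule Tietze[OF cont(1), of UNIV M]) (use K(1) M in auto)
  obtain L \<phi> where L: "closed L" "L \<subseteq> \<Omega>"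
    "emeasure lebesgue (\<Omega> - L) \<le> ennreal (\<epsilon> / 2) * emeasure lebesgue \<Omega>"
    and \<phi>: "\<phi> \<in> C1_0 \<Omega>" "\<And>x. x \<in> L \<Longrightarrow> w x = gradient \<phi> x"
    using Lusin_gradient_continuous[OF assms(2) \<Omega> \<open>\<epsilon> / 2 > 0\<close> w(1)] w(3) by (metis UNIV_I)
  define A where "A = \<Omega> - K \<union> (\<Omega> - L)"
  have "emeasure lebesgue A \<le> emeasure lebesgue (\<Omega> - K) + emeasure lebesgue (\<Omega> - L)"
    unfolding A_def using \<Omega> K(1) L(1) by (intro emeasure_subadditive) auto
  also have "\<dots> \<le> ennreal (\<epsilon> / 2) * emeasure lebesgue \<Omega> + ennreal (\<epsilon> / 2) * emeasure lebesgue \<Omega>"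
    using K(2) L(3) by (rule add_mono)
  also have "\<dots> = ennreal \<epsilon> * emeasure lebesgue \<Omega>"
    using assms(5) by (simp add: distrib_right[symmetric] ennreal_plus[symmetric] del: ennreal_plus)
  finally have "emeasure lebesgue A \<le> ennreal \<epsilon> * emeasure lebesgue \<Omega>" .
  moreover have "open A"
    unfolding A_def using assms(2) K(1) L(1) by (intro open_Un open_Diff)
  moreover have "\<forall>x\<in>\<Omega> - A. v x = gradient \<phi> x"
  proof
    fix x assume "x \<in> \<Omega> - A"
    then have "x \<in> K" "x \<in> L" by (auto simp: A_def)
    then show "v x = gradient \<phi> x" using w(2)[of x] \<phi>(2)[of x] by simp
  qed
  ultimately show ?thesis
    using \<phi>(1) by (intro exI[of _ A] exI[of _ \<phi>]) (auto simp: A_def)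
qed

end
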